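(* Let $\Pi$ be a Gibbs partition with parameters $(\alpha,V)$, let $n,m\ge1$, and condition on the restriction of $\Pi$ to $[n]$ being a given partition into $j$ blocks with sizes $(n_1,\dots,n_j)$. For $i=1,\dots,j$ let $M_{i,m}$ be the number of integers among $n+1,\dots,n+m$ that fall in the $i$-th old block. Then for $1\le r\le j$ and all integers $m_1,\dots,m_r\ge0$ with $\sum_{i=1}^r m_i\le m$, $$\mathbb{P}(M_{1,m}=m_1,\dots,M_{r,m}=m_r\mid n_1,\dots,n_j)=\frac{m!\,\prod_{i=1}^r(n_i-\alpha)_{m_i}}{\prod_{i=1}^r m_i!\,(m-\sum_{i=1}^r m_i)!}\sum_{k=0}^{m-\sum_{i=1}^r m_i}\frac{V_{n+m,j+k}}{V_{n,j}}\,S^{-1,-\alpha,-(n-(j-r)\alpha-\sum_{i=1}^r n_i)}_{m-\sum_{i=1}^r m_i,\;k}.$$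
   Context: Notation: $(x)_n=x(x+1)\cdots(x+n-1)$ ($(x)_0=1$). Gibbs partition with parameters $(\alpha,V)$: $\alpha\in(-\infty,1)$ and $V=(V_{n,k})_{1\le k\le n}$ are nonnegative weights with $V_{1,1}=1$ and $V_{n,k}=(n-k\alpha)V_{n+1,k}+V_{n+1,k+1}$; $\Pi$ is the exchangeable random partition of the positive integers such that for every $n$ and every partition $\{A_1,\dots,A_k\}$ of $[n]=\{1,\dots,n\}$, the restriction $\Pi_n$ of $\Pi$ to $[n]$ satisfies $\mathbb{P}(\Pi_n=\{A_1,\dots,A_k\})=V_{n,k}\prod_{i=1}^k(1-\alpha)_{|A_i|-1}$. Conditional setting: it is assumed $V_{n,j}>0$. Given $\Pi_n$ (with $j$ blocks of sizes $n_1,\dots,n_j$), a block of $\Pi_{n+m}$ is old if it meets $[n]$, new otherwise; the $i$-th old block is the one containing the $i$-th block of $\Pi_n$. The conditional probability that $\Pi_{n+m}$ equals a specified partition extending $\Pi_n$, in which the old blocks gain $m_1,\dots,m_j\ge0$ elements and there are $k$ new blocks of sizes $s_1,\dots,s_k\ge1$, is $\frac{V_{n+m,j+k}}{V_{n,j}}\prod_{i=1}^j(n_i-\alpha)_{m_i}\prod_{i=1}^k(1-\alpha)_{s_i-1}$. Generalized central Stirling numbers: $S^{-1,-\alpha}_{n,k}=\frac{n!}{k!}\sum_{(n_1,\dots,n_k)}\prod_{j=1}^k\frac{(1-\alpha)_{n_j-1}}{n_j!}$, the sum being over compositions of $n$ into $k$ positive parts ($S_{0,0}^{-1,-\alpha}=1$,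 $S_{n,0}^{-1,-\alpha}=0$ for $n\ge1$, $S_{n,k}^{-1,-\alpha}=0$ for $k>n$). Generalized non-central Stirling numbers: $S^{-1,-\alpha,\gamma}_{n,k}=\sum_{s=k}^n\binom ns S^{-1,-\alpha}_{s,k}(-\gamma)_{n-s}$. *)

theory Defs
  imports "HOL-Probability.Probability" "HOL-Combinatorics.Permutations"
begin

section \<open>Random partitions of the positive integers\<close>

definition restrict_partition :: "nat \<Rightarrow> nat set set \<Rightarrow> nat set set" where
  "restrict_partition n P = (\<inter>) {1..n} ` P - {{}}"

lemma partition_on_restrict_partition:
  assumes "partition_on {1..} P"
  shows "partition_on {1..n} (restrict_partition n P)"
  unfolding restrict_partition_def
  using partition_on_restrict[OF assms, of "{1..n}"] by (simp add: Int_absorb2)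

text \<open>
  The events in \<open>restrict_event\<close> generate the usual sigma-algebra on the set of partitions of the
  positive integers.
\<close>

locale random_partition = prob_space M
  for M :: "'a measure" and \<pi> :: "'a \<Rightarrow> nat set set" +
  assumes partition_on_\<pi>: "\<And>\<omega>. \<omega> \<in> space M \<Longrightarrow> partition_on {1..} (\<pi> \<omega>)"
    and restrict_event: "\<And>n P. partition_on {1..n} P \<Longrightarrow>
      {\<omega> \<in> space M. restrict_partition n (\<pi> \<omega>) = P} \<in> sets M"

locale exchangeable_partition = random_partition M \<pi>
  for M :: "'a measure" and \<pi> :: "'a \<Rightarrow> nat set set" +
  assumes exchangeable: "\<And>n \<sigma> P. \<sigma> permutes {1..n} \<Longrightarrow> partition_on {1..n} P \<Longrightarrow>
      \<P>(\<omega> in M. restrict_partition n (\<pi> \<omega>) = (`) \<sigma> ` P)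
    = \<P>(\<omega> in M. restrict_partition n (\<pi> \<omega>) = P)"

section \<open>Gibbs partitions\<close>

text \<open>Only the entries \<open>V n k\<close> with \<open>1 \<le> k \<le> n\<close> are meaningful; the others are unconstrained.\<close>

locale gibbs_weights =
  fixes \<alpha> :: real and V :: "nat \<Rightarrow> nat \<Rightarrow> real"
  assumes \<alpha>_less_1: "\<alpha> < 1"
    and V_nonneg: "\<And>n k. 1 \<le> k \<Longrightarrow> k \<le> n \<Longrightarrow> 0 \<le> V n k"
    and V_1_1: "V 1 1 = 1"
    and V_rec: "\<And>n k. 1 \<le> k \<Longrightarrow> k \<le> n \<Longrightarrow>
      V n k = (real n - real k * \<alpha>) * V (n + 1) k + V (n + 1) (k + 1)"

locale gibbs_partition = gibbs_weights \<alpha> V + exchangeable_partition M \<pi>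
  for \<alpha> :: real and V :: "nat \<Rightarrow> nat \<Rightarrow> real"
    and M :: "'a measure" and \<pi> :: "'a \<Rightarrow> nat set set" +
  assumes prob_restrict: "\<And>n P. 1 \<le> n \<Longrightarrow> partition_on {1..n} P \<Longrightarrow>
      \<P>(\<omega> in M. restrict_partition n (\<pi> \<omega>) = P)
    = V n (card P) * (\<Prod>B\<in>P. pochhammer (1 - \<alpha>) (card B - 1))"

text \<open>
  Exchangeability is part of the definition, but it already follows from the product formula.
\<close>

lemma gibbs_partitionI:
  assumes "gibbs_weights \<alpha> V" and "random_partition M \<pi>"
    and prob: "\<And>n P. 1 \<le> n \<Longrightarrow> partition_on {1..n} P \<Longrightarrow>
      \<P>(\<omega> in M. restrict_partition n (\<pi> \<omega>) = P)
    = V n (card P) * (\<Prod>B\<in>P. pochhammer (1 - \<alpha>) (card B - 1))"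
  shows "gibbs_partition \<alpha> V M \<pi>"
proof -
  interpret gibbs_weights \<alpha> V by fact
  interpret random_partition M \<pi> by fact
  show ?thesis
  proof unfold_locales
    fix n :: nat and \<sigma> :: "nat \<Rightarrow> nat" and P :: "nat set set"
    assume \<sigma>: "\<sigma> permutes {1..n}" and P: "partition_on {1..n} P"
    have inj: "inj \<sigma>"
      using \<sigma> by (rule permutes_inj)
    have inj_img: "inj_on ((`) \<sigma>) P"
      using inj by (simp add: inj_on_def inj_image_eq_iff)
    have P': "partition_on {1..n} ((`) \<sigma> ` P)"
    proof -
      have "partition_on {1..n} ((`) \<sigma> ` P - {{}})"
        using partition_on_inj_image[OF P permutes_inj_on[OF \<sigma>]] permutes_image[OF \<sigma>] by simp
      moreover have "(`) \<sigma> ` P - {{}} = (`) \<sigma> ` P"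
        using partition_onD3[OF P] by auto
      ultimately show ?thesis
        by simp
    qed
    show "\<P>(\<omega> in M. restrict_partition n (\<pi> \<omega>) = (`) \<sigma> ` P)
        = \<P>(\<omega> in M. restrict_partition n (\<pi> \<omega>) = P)"
    proof (cases "n = 0")
      case True
      then have "P = {}"
        using P by (simp add: partition_on_empty)
      then show ?thesis
        by simp
    next
      case False
      have "card ((`) \<sigma> ` P) = card P"
        using inj_img by (rule card_image)
      moreover have "card (\<sigma> ` B) = card B" for B
        using inj by (intro card_image) (auto intro: inj_on_subset)
      ultimately show ?thesis
        using False by (simp add: prob[OF _ P] prob[OF _ P'] prod.reindex[OF inj_img])
    qed
  qed (use prob in auto)
qed

text \<open>
  If \<open>A\<close> is a block of the restriction of \<open>P\<close> to \<open>{1..n}\<close>, then \<open>old_block n m P A\<close> is the unique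
  block of the restriction of \<open>P\<close> to \<open>{1..n + m}\<close> that contains \<open>A\<close>.
\<close>

definition old_block :: "nat \<Rightarrow> nat \<Rightarrow> nat set set \<Rightarrow> nat set \<Rightarrow> nat set" where
  "old_block n m P A = (THE B. B \<in> restrict_partition (n + m) P \<and> A \<subseteq> B)"

definition old_block_gain :: "nat \<Rightarrow> nat \<Rightarrow> nat set set \<Rightarrow> nat set \<Rightarrow> nat" where
  "old_block_gain n m P A = card (old_block n m P A \<inter> {n + 1..n + m})"

lemma ex1_old_block:
  assumes P: "partition_on {1..} P" and A: "A \<in> restrict_partition n P"
  shows "\<exists>!B. B \<in> restrict_partition (n + m) P \<and> A \<subseteq> B"
proof -
  from A obtain C where C: "C \<in> P" "A = {1..n} \<inter> C" "A \<noteq> {}"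
    by (auto simp: restrict_partition_def)
  have part: "partition_on {1..n + m} (restrict_partition (n + m) P)"
    using P by (rule partition_on_restrict_partition)
  show ?thesis
  proof (rule ex_ex1I)
    show "\<exists>B. B \<in> restrict_partition (n + m) P \<and> A \<subseteq> B"
    proof (intro exI conjI)
      have sub: "A \<subseteq> {1..n + m} \<inter> C"
        using C(2) by auto
      then show "{1..n + m} \<inter> C \<in> restrict_partition (n + m) P"
        using C(1,3) by (auto simp: restrict_partition_def simp del: atLeastAtMost_iff)
      show "A \<subseteq> {1..n + m} \<inter> C"
        by (fact sub)
    qed
  next
    fix B B'
    assume "B \<in> restrict_partition (n + m) P \<and> A \<subseteq> B"
      and "B' \<in> restrict_partition (n + m) P \<and> A \<subseteq> B'"
    moreover from this have "B \<inter> B' \<noteq> {}"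
      using C(3) by blast
    ultimately show "B = B'"
      using partition_onD2[OF part] by (meson disjointD)
  qed
qed

section \<open>Generalized Stirling numbers\<close>

definition compositions :: "nat \<Rightarrow> nat \<Rightarrow> nat list set" where
  "compositions n k = {ns. length ns = k \<and> sum_list ns = n \<and> (\<forall>x\<in>set ns. 1 \<le> x)}"

lemma finite_compositions: "finite (compositions n k)"
proof (rule finite_subset)
  show "compositions n k \<subseteq> {ns. set ns \<subseteq> {..n} \<and> length ns = k}"
    by (auto simp: compositions_def intro: member_le_sum_list)
  show "finite {ns. set ns \<subseteq> {..n} \<and> length ns = k}"
    by (rule finite_lists_length_eq) simp
qed

text \<open>\<open>gen_stirling \<alpha> n k\<close> is $S^{-1,-\alpha}_{n,k}$.\<close>

definition gen_stirling :: "real \<Rightarrow> nat \<Rightarrow> nat \<Rightarrow> real" where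
  "gen_stirling \<alpha> n k = fact n / fact k *
     (\<Sum>ns\<in>compositions n k. \<Prod>i<k. pochhammer (1 - \<alpha>) (ns ! i - 1) / fact (ns ! i))"

lemma gen_stirling_0_0: "gen_stirling \<alpha> 0 0 = 1"
proof -
  have "compositions 0 0 = {[]}"
    by (auto simp: compositions_def)
  then show ?thesis
    by (simp add: gen_stirling_def)
qed

lemma gen_stirling_n_0: "1 \<le> n \<Longrightarrow> gen_stirling \<alpha> n 0 = 0"
  by (auto simp: gen_stirling_def compositions_def)

lemma gen_stirling_eq_0:
  assumes "n < k"
  shows "gen_stirling \<alpha> n k = 0"
proof -
  have "length ns \<le> sum_list ns" if "\<forall>x\<in>set ns. 1 \<le> x" for ns :: "nat list"
    using that by (induction ns) auto
  then have "compositions n k = {}"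
    using assms by (fastforce simp: compositions_def)
  then show ?thesis
    by (simp add: gen_stirling_def)
qed

text \<open>\<open>nc_gen_stirling \<alpha> \<gamma> n k\<close> is $S^{-1,-\alpha,\gamma}_{n,k}$.\<close>

definition nc_gen_stirling :: "real \<Rightarrow> real \<Rightarrow> nat \<Rightarrow> nat \<Rightarrow> real" where
  "nc_gen_stirling \<alpha> \<gamma> n k =
     (\<Sum>s = k..n. real (n choose s) * gen_stirling \<alpha> s k * pochhammer (- \<gamma>) (n - s))"

end

theory Submission
  imports Defs "HOL-Computational_Algebra.Formal_Power_Series"
begin

text \<open>
  The conditional probability is, up to normalization, a sum of block weights over all partitions of
  \<open>{1..n + m}\<close> that extend the given partition, have the prescribed gains and have \<open>j + k\<close> blocks,
  weighted by \<open>V (n + m) (j + k)\<close>. The last element either is a new singleton or joins a block \<open>B\<close>,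
  which multiplies the weight by \<open>card B - \<alpha>\<close>; this gives a recursion on the number of
  added elements. The right-hand side satisfies the same recursion: with
  $\phi(x) = \sum_{n \ge 1} (1-\alpha)_{n-1} x^n / n!$, the numbers $S^{-1,-\alpha,-\rho}_{n,k} / n!$
  are the coefficients of $H_k = \phi^k (1-x)^{-\rho} / k!$, and $(1-x) \phi' = 1 - \alpha\phi$ yields
  $(1-x) H_k' = H_{k-1} + (\rho - k\alpha) H_k$.
\<close>

unbundle fps_syntax

section \<open>Generating functions of generalized Stirling numbers\<close>

text \<open>This is (1 - (1-x)^\<alpha>) / \<alpha>, or -log (1-x) when \<alpha> = 0. The case split
  matters: at \<open>n = 0\<close> truncated subtraction would produce the constant term 1.\<close>

definition stirling_fps :: "real \<Rightarrow> real fps" where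
  "stirling_fps \<alpha> = Abs_fps (\<lambda>n. if n = 0 then 0 else pochhammer (1 - \<alpha>) (n - 1) / fact n)"

text \<open>Beyond the constant coefficient this is (1-\<alpha>)_n = (n-\<alpha>)
  (1-\<alpha>)_{n-1}, read off coefficient by coefficient.\<close>

lemma stirling_fps_ODE:
  "(1 - fps_X) * fps_deriv (stirling_fps \<alpha>) = 1 - fps_const \<alpha> * stirling_fps \<alpha>"
proof (rule fps_ext)
  fix n
  show "((1 - fps_X) * fps_deriv (stirling_fps \<alpha>)) $ n = (1 - fps_const \<alpha> * stirling_fps \<alpha>) $ n"
  proof (cases n)
    case 0
    then show ?thesis by (simp add: stirling_fps_def left_diff_distrib)
  next
    case (Suc k)
    have "fact (Suc k) = real (Suc k) * fact k" "fact k \<noteq> (0::real)" by simp_all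
    with Suc show ?thesis
      by (simp add: stirling_fps_def left_diff_distrib pochhammer_Suc divide_simps
          del: fact_Suc) (simp add: algebra_simps)
  qed
qed

text \<open>The binomial series of (1-x)^(-\<rho>).\<close>

definition pochhammer_fps :: "real \<Rightarrow> real fps" where
  "pochhammer_fps \<rho> = Abs_fps (\<lambda>n. pochhammer \<rho> n / fact n)"

lemma pochhammer_fps_ODE:
  "(1 - fps_X) * fps_deriv (pochhammer_fps \<rho>) = fps_const \<rho> * pochhammer_fps \<rho>"
proof (rule fps_ext)
  fix n
  show "((1 - fps_X) * fps_deriv (pochhammer_fps \<rho>)) $ n = (fps_const \<rho> * pochhammer_fps \<rho>) $ n"
  proof (cases n)
    case 0
    then show ?thesis by (simp add: pochhammer_fps_def left_diff_distrib)
  next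
    case (Suc k)
    have "fact (Suc k) = real (Suc k) * fact k" "fact k \<noteq> (0::real)" by simp_all
    with Suc show ?thesis
      by (simp add: pochhammer_fps_def left_diff_distrib pochhammer_Suc divide_simps
          del: fact_Suc) (simp add: algebra_simps)
  qed
qed

text \<open>The parameter \<open>\<rho>\<close> is minus the non-centrality parameter of
  \<open>nc_gen_stirling\<close>.\<close>

definition nc_stirling_fps :: "real \<Rightarrow> real \<Rightarrow> nat \<Rightarrow> real fps" where
  "nc_stirling_fps \<alpha> \<rho> k = fps_const (1 / fact k) * stirling_fps \<alpha> ^ k * pochhammer_fps \<rho>"

lemma nc_stirling_fps_ODE_0:
  "(1 - fps_X) * fps_deriv (nc_stirling_fps \<alpha> \<rho> 0) = fps_const \<rho> * nc_stirling_fps \<alpha> \<rho> 0"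
  by (simp add: nc_stirling_fps_def pochhammer_fps_ODE)

text \<open>Product rule. In (1-x) \<phi>' = 1 - \<alpha>\<phi> the 1 leaves \<phi>^k, with the
  factor k+1 cancelling in the factorial, while -\<alpha>\<phi> restores the power k+1 and
  contributes -(k+1)\<alpha>.\<close>

lemma nc_stirling_fps_ODE_Suc:
  "(1 - fps_X) * fps_deriv (nc_stirling_fps \<alpha> \<rho> (Suc k)) =
     nc_stirling_fps \<alpha> \<rho> k + fps_const (\<rho> - real (Suc k) * \<alpha>) * nc_stirling_fps \<alpha> \<rho> (Suc k)"
proof -
  define c where "c = fps_const (1 / fact (Suc k) :: real)"
  define \<phi> G where "\<phi> = stirling_fps \<alpha>" and "G = pochhammer_fps \<rho>"
  have c: "c * fps_const (real (Suc k)) = fps_const (1 / fact k)"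
    by (simp add: c_def divide_simps)
  have c_deriv: "fps_deriv c = 0"
    by (simp add: c_def)
  have power_deriv: "fps_deriv (\<phi> ^ Suc k) = fps_const (real (Suc k)) * \<phi> ^ k * fps_deriv \<phi>"
    unfolding fps_deriv_power by simp
  have "(1 - fps_X) * fps_deriv (nc_stirling_fps \<alpha> \<rho> (Suc k)) =
      c * fps_const (real (Suc k)) * \<phi> ^ k * ((1 - fps_X) * fps_deriv \<phi>) * G
      + c * \<phi> ^ Suc k * ((1 - fps_X) * fps_deriv G)"
    unfolding nc_stirling_fps_def c_def[symmetric] \<phi>_def[symmetric] G_def[symmetric]
      fps_deriv_mult power_deriv c_deriv by algebra
  also have "\<dots> = c * fps_const (real (Suc k)) * \<phi> ^ k * G
      + fps_const (\<rho> - real (Suc k) * \<alpha>) * (c * \<phi> ^ Suc k * G)"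
    unfolding \<phi>_def G_def stirling_fps_ODE pochhammer_fps_ODE fps_const_sub[symmetric] fps_const_mult[symmetric]
    by (simp only: power_Suc) algebra
  finally show ?thesis
    unfolding c by (simp add: nc_stirling_fps_def c_def \<phi>_def G_def)
qed

lemma fps_nth_one_minus_X_deriv:
  "((1 - fps_X) * fps_deriv (F :: real fps)) $ N = real (N + 1) * F $ (N + 1) - real N * F $ N"
  by (cases N) (simp_all add: left_diff_distrib)

text \<open>Compares the coefficients of x^N in the differential equation; the term N F_N from the
  factor 1-x turns \<open>\<rho>\<close> into \<open>N + \<rho>\<close>.\<close>

lemma nc_stirling_fps_rec:
  "real (N + 1) * nc_stirling_fps \<alpha> \<rho> k $ (N + 1) =
     (if k = 0 then 0 else nc_stirling_fps \<alpha> \<rho> (k - 1) $ N)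
     + (real N + \<rho> - real k * \<alpha>) * nc_stirling_fps \<alpha> \<rho> k $ N"
proof -
  have "((1 - fps_X) * fps_deriv (nc_stirling_fps \<alpha> \<rho> k)) $ N =
      (if k = 0 then 0 else nc_stirling_fps \<alpha> \<rho> (k - 1) $ N)
      + (\<rho> - real k * \<alpha>) * nc_stirling_fps \<alpha> \<rho> k $ N"
    by (cases k) (simp_all add: nc_stirling_fps_ODE_0 nc_stirling_fps_ODE_Suc)
  then show ?thesis
    unfolding fps_nth_one_minus_X_deriv by (simp add: algebra_simps del: of_nat_add of_nat_Suc)
qed

lemma nc_stirling_fps_nth_0: "nc_stirling_fps \<alpha> \<rho> k $ 0 = of_bool (k = 0)"
  by (simp add: nc_stirling_fps_def stirling_fps_def pochhammer_fps_def)

section \<open>Stirling numbers as coefficients of these series\<close>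

text \<open>A coefficient of a k-th power is a sum over compositions into k possibly zero parts;
  those with a zero part vanish because the series has no constant term.\<close>

lemma gen_stirling_eq_fps_nth:
  "gen_stirling \<alpha> n k = fact n / fact k * (stirling_fps \<alpha> ^ k) $ n"
proof -
  have "(\<Sum>ns\<in>compositions n k. \<Prod>i<k. pochhammer (1 - \<alpha>) (ns ! i - 1) / fact (ns ! i))
      = (\<Sum>v\<in>natpermute n k. \<Prod>i<k. stirling_fps \<alpha> $ (v ! i))"
  proof (intro sum.mono_neutral_cong_left natpermute_finite ballI)
    show "compositions n k \<subseteq> natpermute n k"
      by (auto simp: compositions_def natpermute_def)
  next
    fix v assume v: "v \<in> natpermute n k - compositions n k"
    then obtain i where "i < k" "v ! i = 0"
      by (auto simp: compositions_def natpermute_def in_set_conv_nth not_less_eq_eq)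
    then show "(\<Prod>i<k. stirling_fps \<alpha> $ (v ! i)) = 0"
      by (auto simp: stirling_fps_def intro!: bexI[of _ i])
  next
    fix v assume v: "v \<in> compositions n k"
    have "v ! i \<noteq> 0" if "i < k" for i
    proof -
      have "v ! i \<in> set v"
        using v that by (simp add: compositions_def)
      then have "1 \<le> v ! i"
        using v unfolding compositions_def by blast
      then show ?thesis
        by simp
    qed
    then show "(\<Prod>i<k. pochhammer (1 - \<alpha>) (v ! i - 1) / fact (v ! i)) = (\<Prod>i<k. stirling_fps \<alpha> $ (v ! i))"
      by (intro prod.cong) (auto simp: stirling_fps_def)
  qed
  also have "\<dots> = (stirling_fps \<alpha> ^ k) $ n"
  proof (cases k)
    case 0
    then show ?thesis
      by (simp add: natpermute_0)
  next
    case (Suc k')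
    then show ?thesis
      by (simp add: fps_power_nth_Suc lessThan_Suc_atMost atLeast0AtMost del: power_Suc)
  qed
  finally show ?thesis
    by (simp add: gen_stirling_def)
qed

text \<open>The product of two exponential generating functions is a binomial convolution; its terms
  with \<open>s < k\<close> vanish.\<close>

lemma nc_gen_stirling_eq_fps_nth:
  "nc_gen_stirling \<alpha> (- \<rho>) n k = fact n * nc_stirling_fps \<alpha> \<rho> k $ n"
proof -
  have "fact n * nc_stirling_fps \<alpha> \<rho> k $ n =
      (\<Sum>s=0..n. real (n choose s) * gen_stirling \<alpha> s k * pochhammer \<rho> (n - s))"
    unfolding nc_stirling_fps_def mult.assoc fps_mult_left_const_nth
    unfolding fps_mult_nth sum_distrib_left
    by (intro sum.cong refl)
      (simp add: pochhammer_fps_def gen_stirling_eq_fps_nth binomial_fact)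
  also have "\<dots> = (\<Sum>s=k..n. real (n choose s) * gen_stirling \<alpha> s k * pochhammer \<rho> (n - s))"
    by (rule sum.mono_neutral_right) (auto simp: gen_stirling_eq_0)
  finally show ?thesis
    by (simp add: nc_gen_stirling_def)
qed

section \<open>Extending a partition by one element\<close>

text \<open>The case \<open>B = {}\<close> creates the new block \<open>{x}\<close>.\<close>

definition insert_into :: "'b \<Rightarrow> 'b set \<Rightarrow> 'b set set \<Rightarrow> 'b set set" where
  "insert_into x B Q = insert (insert x B) (Q - {B})"

lemma disjnt_Union_remove: "partition_on X Q \<Longrightarrow> B \<in> Q \<Longrightarrow> disjnt B (\<Union> (Q - {B}))"
  using partition_onD2 by (fastforce simp: disjnt_def dest: disjointD)

text \<open>Allowing \<open>B = {}\<close> treats a new block and an enlarged block alike.\<close>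

lemma partition_on_remove:
  assumes Q: "partition_on X Q" and B: "B \<in> insert {} Q"
  shows "partition_on (X - B) (Q - {B})"
proof (cases "B = {}")
  case True
  then show ?thesis
    using Q partition_onD3[OF Q] by simp
next
  case False
  then have "insert B (Q - {B}) = Q" "disjnt B (\<Union> (Q - {B}))"
    using B disjnt_Union_remove[OF Q] by auto
  then show ?thesis
    using partition_on_insert[of B "Q - {B}" X] Q by simp
qed

lemma partition_on_insert_into:
  assumes Q: "partition_on X Q" and x: "x \<notin> X" and B: "B \<in> insert {} Q"
  shows "partition_on (insert x X) (insert_into x B Q)"
proof -
  have rest: "partition_on (X - B) (Q - {B})"
    using Q B by (rule partition_on_remove)
  have "B \<subseteq> X"
    using B partition_onD1[OF Q] by auto
  moreover have "insert x X - insert x B = X - B"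
    using x by auto
  moreover have "disjnt (insert x B) (\<Union> (Q - {B}))"
    using partition_onD1[OF rest] x by (auto simp: disjnt_def)
  ultimately show ?thesis
    using rest by (simp add: insert_into_def partition_on_insert) auto
qed

text \<open>The inverse deletes \<open>x\<close>: what remains of the block of \<open>x\<close> is
  \<open>B\<close>, possibly empty.\<close>

lemma bij_betw_insert_into:
  assumes x: "x \<notin> X"
  shows "bij_betw (\<lambda>(Q, B). insert_into x B Q) (SIGMA Q:{Q. partition_on X Q}. insert {} Q)
    {Q. partition_on (insert x X) Q}"
proof (rule bij_betw_imageI)
  show "inj_on (\<lambda>(Q, B). insert_into x B Q) (SIGMA Q:{Q. partition_on X Q}. insert {} Q)"
  proof (rule inj_onI, clarify, intro conjI)
    fix Q B Q' B'
    assume Q: "partition_on X Q" "B \<in> insert {} Q" and Q': "partition_on X Q'" "B' \<in> insert {} Q'"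
      and eq: "insert_into x B Q = insert_into x B' Q'"
    have notin: "x \<notin> C" if "C \<in> insert {} Q \<union> insert {} Q'" for C
      using that x partition_onD1[OF Q(1)] partition_onD1[OF Q'(1)] by auto
    \<comment> \<open>Only one block contains \<open>x\<close>, so it can be recognized in the
      result, which determines \<open>B\<close>.\<close>
    have "{C \<in> insert_into x B Q. x \<in> C} = {insert x B}"
      "{C \<in> insert_into x B' Q'. x \<in> C} = {insert x B'}"
      using notin by (auto simp: insert_into_def)
    then have "insert x B = insert x B'"
      using eq by (metis singleton_inject)
    then show B: "B = B'"
      using notin Q(2) Q'(2) by (metis UnI1 UnI2 insert_ident)
    have "insert_into x B Q - {insert x B} = Q - {B}" "insert_into x B' Q' - {insert x B'} = Q' - {B'}"
      using notin by (auto simp: insert_into_def)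
    then have "Q - {B} = Q' - {B}"
      using eq B by simp
    then show "Q = Q'"
      using Q(2) Q'(2) B partition_onD3[OF Q(1)] partition_onD3[OF Q'(1)] by blast
  qed
  show "(\<lambda>(Q, B). insert_into x B Q) ` (SIGMA Q:{Q. partition_on X Q}. insert {} Q)
      = {Q. partition_on (insert x X) Q}"
  proof (intro equalityI subsetI)
    fix R assume "R \<in> {Q. partition_on (insert x X) Q}"
    then have R: "partition_on (insert x X) R"
      by simp
    then obtain C where C: "C \<in> R" "x \<in> C"
      using partition_onD1[OF R] by auto
    \<comment> \<open>Subtracting \<open>{{}}\<close> drops the remainder when \<open>C\<close> is
      the singleton \<open>{x}\<close>.\<close>
    define Q where "Q = (R - {C}) \<union> ({C - {x}} - {{}})"
    have rest: "partition_on (insert x X - C) (R - {C})"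
      using partition_on_remove[OF R, of C] C by simp
    have "partition_on X Q"
    proof (cases "C = {x}")
      case True
      then show ?thesis
        using rest x by (simp add: Q_def)
    next
      case False
      then have ne: "C - {x} \<noteq> {}" "C - {x} \<subseteq> X"
        using C partition_onD1[OF R] by auto
      moreover have "X - (C - {x}) = insert x X - C"
        using x C by auto
      moreover have "disjnt (C - {x}) (\<Union> (R - {C}))"
        using partition_onD1[OF rest] by (auto simp: disjnt_def)
      moreover have "Q = insert (C - {x}) (R - {C})"
        using ne by (auto simp: Q_def)
      ultimately show ?thesis
        using rest by (simp add: partition_on_insert)
    qed
    moreover have "C - {x} \<in> insert {} Q"
      by (auto simp: Q_def)
    moreover have "insert_into x (C - {x}) Q = R"
    proof -
      \<comment> \<open>Otherwise removing \<open>C - {x}\<close> from \<open>Q\<close> would also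
        lose another block of \<open>R\<close>.\<close>
      have "C - {x} \<notin> R - {C}"
      proof
        assume mem: "C - {x} \<in> R - {C}"
        then have "C - {x} \<subseteq> insert x X - C"
          using partition_onD1[OF rest] by blast
        then have "C - {x} = {}"
          by blast
        then show False
          using mem partition_onD3[OF R] by (metis DiffD1)
      qed
      moreover have "insert x (C - {x}) = C"
        using C by auto
      moreover have "{} \<notin> R"
        using R by (rule partition_onD3)
      ultimately show ?thesis
        using C(1) by (auto simp: insert_into_def Q_def)
    qed
    ultimately show "R \<in> (\<lambda>(Q, B). insert_into x B Q) ` (SIGMA Q:{Q. partition_on X Q}. insert {} Q)"
      by (intro image_eqI[of _ _ "(Q, C - {x})"]) auto
  qed (use partition_on_insert_into[OF _ x] in auto)
qed

text \<open>The old and the enlarged block have the same intersection with \<open>Y\<close>; empty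
  intersections are discarded anyway.\<close>

lemma trace_insert_into:
  assumes "x \<notin> Y" "B \<in> insert {} Q"
  shows "(\<inter>) Y ` insert_into x B Q - {{}} = (\<inter>) Y ` Q - {{}}"
proof -
  have "Y \<inter> insert x B = Y \<inter> B"
    using assms(1) by auto
  then show ?thesis
    using assms(2) by (auto simp: insert_into_def)
qed

lemma card_partition_le:
  assumes "finite X" "partition_on X Q"
  shows "card Q \<le> card X"
proof -
  have fin: "finite B" "B \<noteq> {}" if "B \<in> Q" for B
    using that assms partition_onD1[OF assms(2)] partition_onD3[OF assms(2)]
    by (auto intro: finite_subset)
  have "card Q = (\<Sum>B\<in>Q. 1)" by simp
  also have "\<dots> \<le> (\<Sum>B\<in>Q. card B)"
    using fin by (intro sum_mono) (simp add: card_gt_0_iff Suc_le_eq)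
  also have "\<dots> = card X"
    using product_partition[OF assms(2)] fin by simp
  finally show ?thesis .
qed

text \<open>The Gibbs probability without its factor from \<open>V\<close>, which depends only on
  the number of blocks.\<close>

definition block_weight :: "real \<Rightarrow> 'b set set \<Rightarrow> real" where
  "block_weight \<alpha> Q = (\<Prod>B\<in>Q. pochhammer (1 - \<alpha>) (card B - 1))"

text \<open>A singleton has weight 1, and enlarging a block of size b multiplies (1-\<alpha>)_{b-1}
  by b-\<alpha>.\<close>

lemma block_weight_insert_into:
  assumes X: "finite X" and Q: "partition_on X Q" and x: "x \<notin> X" and B: "B \<in> insert {} Q"
  shows "block_weight \<alpha> (insert_into x B Q) = (if B = {} then 1 else real (card B) - \<alpha>) * block_weight \<alpha> Q"
proof -
  have fin: "finite Q" "finite B" "x \<notin> B"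
    using B x partition_onD1[OF Q] finite_elements[OF X Q] X by (auto intro: finite_subset)
  have new: "insert x B \<notin> Q - {B}"
    using x partition_onD1[OF Q] by auto
  have "block_weight \<alpha> (insert_into x B Q) =
      pochhammer (1 - \<alpha>) (card B) * block_weight \<alpha> (Q - {B})"
    using fin new by (simp add: insert_into_def block_weight_def)
  also have "\<dots> = (if B = {} then 1 else real (card B) - \<alpha>) * block_weight \<alpha> Q"
  proof (cases "B = {}")
    case True
    then show ?thesis
      using partition_onD3[OF Q] by simp
  next
    case False
    then obtain b where b: "card B = Suc b"
      using fin(2) by (metis card_eq_0_iff not0_implies_Suc)
    have "block_weight \<alpha> Q = pochhammer (1 - \<alpha>) (card B - 1) * block_weight \<alpha> (Q - {B})"
      using B False fin by (simp add: block_weight_def prod.remove)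
    then show ?thesis
      using False b by (simp add: pochhammer_Suc algebra_simps)
  qed
  finally show ?thesis .
qed

section \<open>Extensions of a finite partition with indexed blocks\<close>

locale indexed_partition =
  fixes A :: "'i \<Rightarrow> 'b set" and I :: "'i set" and Y :: "'b set"
  assumes finite_Y: "finite Y"
    and partition: "partition_on Y (A ` I)"
    and inj_A: "inj_on A I"
begin

lemma finite_I: "finite I"
  using finite_elements[OF finite_Y partition] inj_A by (rule finite_imageD)

text \<open>New blocks have empty trace on \<open>Y\<close>; subtracting \<open>{{}}\<close> removes
  these traces, so only old blocks are constrained.\<close>

definition extensions :: "'b set \<Rightarrow> 'b set set set" where
  "extensions Z = {Q. partition_on (Y \<union> Z) Q \<and> (\<inter>) Y ` Q - {{}} = A ` I}"

text \<open>The old block that grew out of \<open>A i\<close>, in the same form as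
  \<open>old_block\<close> so that the two agree by unfolding.\<close>

definition block_of :: "'b set set \<Rightarrow> 'i \<Rightarrow> 'b set" where
  "block_of Q i = (THE B. B \<in> Q \<and> A i \<subseteq> B)"

lemma extensionsD:
  assumes "Q \<in> extensions Z"
  shows "partition_on (Y \<union> Z) Q" "(\<inter>) Y ` Q - {{}} = A ` I"
  using assms by (simp_all add: extensions_def)

lemma finite_extensions: "finite Z \<Longrightarrow> finite (extensions Z)"
  unfolding extensions_def
  by (rule finite_subset[OF _ finitely_many_partition_on[of "Y \<union> Z"]]) (use finite_Y in auto)

lemma extensions_empty: "extensions {} = {A ` I}"
proof -
  have eq: "(\<inter>) Y ` Q - {{}} = Q" if "partition_on Y Q" for Q
  proof -
    have "Y \<inter> B = B" if "B \<in> Q" for B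
      using that partition_onD1[OF \<open>partition_on Y Q\<close>] by auto
    then have "(\<inter>) Y ` Q = Q"
      by simp
    then show ?thesis
      using partition_onD3[OF that] by simp
  qed
  have "Q \<in> extensions {} \<longleftrightarrow> Q = A ` I" for Q
    unfolding extensions_def Un_empty_right mem_Collect_eq using eq partition by metis
  then show ?thesis
    by blast
qed

lemma block_of_eqI:
  assumes Q: "Q \<in> extensions Z" and i: "i \<in> I" and B: "B \<in> Q" "A i \<subseteq> B"
  shows "block_of Q i = B"
  unfolding block_of_def
proof (rule the_equality)
  show "B \<in> Q \<and> A i \<subseteq> B"
    using B by simp
next
  fix C assume "C \<in> Q \<and> A i \<subseteq> C"
  moreover have "A i \<noteq> {}"
    using i partition_onD3[OF partition] by auto
  ultimately show "C = B"
    using B disjointD[OF partition_onD2[OF extensionsD(1)[OF Q]], of B C] by blast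
qed

lemma block_of:
  assumes Q: "Q \<in> extensions Z" and i: "i \<in> I"
  shows "block_of Q i \<in> Q" "Y \<inter> block_of Q i = A i"
proof -
  have "A i \<in> (\<inter>) Y ` Q"
    using extensionsD(2)[OF Q] i by blast
  then obtain B where B: "B \<in> Q" "A i = Y \<inter> B"
    by blast
  moreover have "block_of Q i = B"
    using B by (intro block_of_eqI[OF Q i]) auto
  ultimately show "block_of Q i \<in> Q" "Y \<inter> block_of Q i = A i"
    by auto
qed

text \<open>The trace of \<open>block_of Q i\<close> on \<open>Y\<close> gives back
  \<open>A i\<close>, hence \<open>i\<close>.\<close>

lemma inj_on_block_of: "Q \<in> extensions Z \<Longrightarrow> inj_on (block_of Q) I"
  by (rule inj_onI) (metis block_of(2) inj_A inj_onD)

lemma finite_block: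
  assumes "finite Z" "Q \<in> extensions Z" "B \<in> Q"
  shows "finite B"
proof (rule finite_subset)
  show "B \<subseteq> Y \<union> Z"
    using partition_onD1[OF extensionsD(1)[OF assms(2)]] assms(3) by blast
qed (use assms finite_Y in simp)

lemma finite_extension: "finite Z \<Longrightarrow> Q \<in> extensions Z \<Longrightarrow> finite Q"
  using finite_Y extensionsD(1) by (blast intro: finite_elements)

lemma card_block_of_ge:
  assumes "finite Z" "Q \<in> extensions Z" "i \<in> I"
  shows "card (A i) \<le> card (block_of Q i)"
  using block_of[OF assms(2,3)] finite_block[OF assms(1,2)] by (metis card_mono inf.cobounded2)

lemma card_extension_ge:
  assumes "finite Z" "Q \<in> extensions Z"
  shows "card I \<le> card Q"
  using block_of(1)[OF assms(2)] finite_extension[OF assms] inj_on_block_of[OF assms(2)]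
  by (metis card_inj_on_le image_subsetI)

lemma bij_betw_insert_into_extensions:
  assumes x: "x \<notin> Y \<union> Z"
  shows "bij_betw (\<lambda>(Q, B). insert_into x B Q) (SIGMA Q:extensions Z. insert {} Q) (extensions (insert x Z))"
proof -
  let ?f = "\<lambda>(Q, B). insert_into x B Q"
  let ?S = "SIGMA Q:{Q. partition_on (Y \<union> Z) Q}. insert {} Q"
  have bij: "bij_betw ?f ?S {Q. partition_on (Y \<union> insert x Z) Q}"
    using bij_betw_insert_into[OF x] by simp
  have tr: "(\<inter>) Y ` ?f p - {{}} = (\<inter>) Y ` fst p - {{}}" if p: "p \<in> ?S" for p
  proof -
    obtain Q B where p: "p = (Q, B)" "B \<in> insert {} Q"
      using p by (cases p) auto
    show ?thesis
      unfolding p prod.case fst_conv using x p(2) by (intro trace_insert_into) auto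
  qed
  have "(SIGMA Q:extensions Z. insert {} Q) = {p \<in> ?S. (\<inter>) Y ` fst p - {{}} = A ` I}"
    by (rule set_eqI, rename_tac p, case_tac p)
      (simp only: extensions_def mem_Sigma_iff mem_Collect_eq fst_conv conj_ac)
  then have dom: "(SIGMA Q:extensions Z. insert {} Q) = {p \<in> ?S. (\<inter>) Y ` ?f p - {{}} = A ` I}"
    using tr by (simp only: cong: conj_cong)
  have "?f ` {p \<in> ?S. (\<inter>) Y ` ?f p - {{}} = A ` I} = {R \<in> ?f ` ?S. (\<inter>) Y ` R - {{}} = A ` I}"
    by blast
  then have "?f ` (SIGMA Q:extensions Z. insert {} Q) = extensions (insert x Z)"
    unfolding dom bij_betw_imp_surj_on[OF bij] by (simp only: extensions_def mem_Collect_eq)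
  moreover have "(SIGMA Q:extensions Z. insert {} Q) \<subseteq> ?S"
    unfolding dom by blast
  ultimately show ?thesis
    using bij_betw_subset[OF bij] by blast
qed

lemma block_of_insert_into:
  assumes x: "x \<notin> Y \<union> Z" and Q: "Q \<in> extensions Z" and B: "B \<in> insert {} Q" and i: "i \<in> I"
  shows "block_of (insert_into x B Q) i = (if block_of Q i = B then insert x B else block_of Q i)"
proof (rule block_of_eqI)
  show "insert_into x B Q \<in> extensions (insert x Z)"
    using bij_betw_insert_into_extensions[OF x] Q B by (auto simp: bij_betw_def)
qed (use block_of[OF Q i] i in \<open>auto simp: insert_into_def\<close>)

text \<open>The total factor for joining a block outside \<open>R\<close>. Since all block sizes add
  up to the size of the ground set, it depends on \<open>Q\<close> only through its number of blocks
  and the sizes of the blocks indexed by \<open>R\<close>; this closes the recursion.\<close>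

lemma sum_other_blocks:
  assumes Z: "finite Z" "Y \<inter> Z = {}" and Q: "Q \<in> extensions Z" and R: "R \<subseteq> I"
  shows "(\<Sum>B\<in>Q - block_of Q ` R. real (card B) - \<alpha>) =
    real (card Y + card Z) - (\<Sum>i\<in>R. real (card (block_of Q i)))
    - (real (card Q) - real (card R)) * \<alpha>"
proof -
  have sub: "block_of Q ` R \<subseteq> Q"
    using block_of(1)[OF Q] R by auto
  have inj: "inj_on (block_of Q) R"
    using inj_on_block_of[OF Q] R by (rule inj_on_subset)
  note fin = finite_extension[OF Z(1) Q]
  have "card (Y \<union> Z) = (\<Sum>B\<in>Q. card B)"
    using Q finite_block[OF Z(1) Q] by (auto simp: extensions_def intro: product_partition)
  then have total: "(\<Sum>B\<in>Q. real (card B)) = real (card Y + card Z)"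
    using Z finite_Y by (simp add: card_Un_disjoint flip: of_nat_sum)
  have "(\<Sum>B\<in>Q - block_of Q ` R. real (card B) - \<alpha>) =
      (\<Sum>B\<in>Q. real (card B) - \<alpha>) - (\<Sum>B\<in>block_of Q ` R. real (card B) - \<alpha>)"
    using fin sub by (rule sum_diff)
  also have "\<dots> = real (card Y + card Z) - real (card Q) * \<alpha>
      - (\<Sum>i\<in>R. real (card (block_of Q i))) + real (card R) * \<alpha>"
    using total by (simp add: sum.reindex[OF inj] sum_subtractf card_image[OF inj] algebra_simps)
  finally show ?thesis
    by (simp add: algebra_simps)
qed

section \<open>Weighted sums over extensions with prescribed gains\<close>

text \<open>Here \<open>t\<close> prescribes the gains of the old blocks indexed by
  \<open>R\<close>, and \<open>k\<close> counts new blocks. Indicators keep the summation set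
  independent of \<open>t\<close> and \<open>k\<close>.\<close>

definition extension_weight :: "real \<Rightarrow> 'i set \<Rightarrow> 'b set \<Rightarrow> ('i \<Rightarrow> nat) \<Rightarrow> nat \<Rightarrow> real" where
  "extension_weight \<alpha> R Z t k =
     (\<Sum>Q\<in>extensions Z. of_bool (card Q = card I + k \<and>
        (\<forall>i\<in>R. card (block_of Q i) = card (A i) + t i)) * block_weight \<alpha> Q)"

text \<open>The three terms record where \<open>x\<close> goes: into a new singleton, into an old
  block indexed by \<open>R\<close>, or into any other block.\<close>

lemma extension_weight_insert:
  assumes Z: "finite Z" "Y \<inter> Z = {}" and x: "x \<notin> Y \<union> Z" and R: "R \<subseteq> I"
  shows "extension_weight \<alpha> R (insert x Z) t k =
      (if k = 0 then 0 else extension_weight \<alpha> R Z t (k - 1))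
    + (\<Sum>i\<in>R. if t i = 0 then 0
         else (real (card (A i) + t i) - 1 - \<alpha>) * extension_weight \<alpha> R Z (t(i := t i - 1)) k)
    + (real (card Y + card Z) - (\<Sum>i\<in>R. real (card (A i) + t i)) - (real (card I + k) - real (card R)) * \<alpha>)
      * extension_weight \<alpha> R Z t k"
proof -
  define P where "P k t Q \<longleftrightarrow> card Q = card I + k \<and> (\<forall>i\<in>R. card (block_of Q i) = card (A i) + t i)"
    for k and t :: "'i \<Rightarrow> nat" and Q
  define \<phi> where "\<phi> k t Q = of_bool (P k t Q) * block_weight \<alpha> Q" for k and t :: "'i \<Rightarrow> nat" and Q
  have ew: "extension_weight \<alpha> R Z' t k = (\<Sum>Q\<in>extensions Z'. \<phi> k t Q)" for Z' t k
    by (simp add: extension_weight_def \<phi>_def P_def)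
  have finR: "finite R"
    using R finite_I by (rule finite_subset)
  have step: "(\<Sum>B\<in>insert {} Q. \<phi> k t (insert_into x B Q)) =
      (if k = 0 then 0 else \<phi> (k - 1) t Q)
    + (\<Sum>i\<in>R. if t i = 0 then 0
         else (real (card (A i) + t i) - 1 - \<alpha>) * \<phi> k (t(i := t i - 1)) Q)
    + (real (card Y + card Z) - (\<Sum>i\<in>R. real (card (A i) + t i)) - (real (card I + k) - real (card R)) * \<alpha>)
      * \<phi> k t Q"
    if Q: "Q \<in> extensions Z" for Q
  proof -
    have part: "partition_on (Y \<union> Z) Q"
      using Q by (simp add: extensions_def)
    have ne: "{} \<notin> Q"
      using part by (rule partition_onD3)
    have finQ: "finite Q"
      using Z(1) Q by (rule finite_extension)
    have notin: "x \<notin> B" if "B \<in> insert {} Q" for B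
      using that x partition_onD1[OF part] by auto
    have finB: "finite B" if "B \<in> insert {} Q" for B
      using that finite_block[OF Z(1) Q] by auto
    have card: "card (insert_into x B Q) = card Q + of_bool (B = {})" if B: "B \<in> insert {} Q" for B
    proof -
      have "insert x B \<notin> Q"
        using notin by blast
      then have "card (insert_into x B Q) = Suc (card (Q - {B}))"
        using finQ by (simp add: insert_into_def)
      also have "\<dots> = card Q + of_bool (B = {})"
        using B ne finQ card_Suc_Diff1[of Q B] by auto
      finally show ?thesis .
    qed
    have size: "card (block_of (insert_into x B Q) i) = card (block_of Q i) + of_bool (block_of Q i = B)"
      if B: "B \<in> insert {} Q" and i: "i \<in> I" for B i
      using notin[OF B] finB[OF B] by (simp add: block_of_insert_into[OF x Q B i])
    have weight: "block_weight \<alpha> (insert_into x B Q) = (if B = {} then 1 else real (card B) - \<alpha>) * block_weight \<alpha> Q"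
      if "B \<in> insert {} Q" for B
      using block_weight_insert_into[OF _ part x that] finite_Y Z(1) by simp
    have "block_of Q i \<noteq> {}" if "i \<in> R" for i
      using that R block_of(1)[OF Q] ne by (metis subsetD)
    \<comment> \<open>For \<open>k = 0\<close> the indicator vanishes, since \<open>Q\<close>
      already has at least \<open>card I\<close> blocks.\<close>
    then have new: "\<phi> k t (insert_into x {} Q) = (if k = 0 then 0 else \<phi> (k - 1) t Q)"
      using R card_extension_ge[OF Z(1) Q]
      by (auto simp: \<phi>_def P_def card size weight subset_iff)
    have other: "\<phi> k t (insert_into x B Q) = \<phi> k t Q * (real (card B) - \<alpha>)"
      if "B \<in> Q - block_of Q ` R" for B
    proof -
      have "B \<noteq> {}" and "block_of Q i \<noteq> B" if "i \<in> R" for i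
        using \<open>B \<in> Q - block_of Q ` R\<close> that ne by auto
      then show ?thesis
        using that ne R by (auto simp: \<phi>_def P_def card size weight subset_iff)
    qed
    have old: "\<phi> k t (insert_into x (block_of Q i) Q) = (if t i = 0 then 0
         else (real (card (A i) + t i) - 1 - \<alpha>) * \<phi> k (t(i := t i - 1)) Q)" if i: "i \<in> R" for i
    proof -
      have iI: "i \<in> I" and B: "block_of Q i \<in> insert {} Q" and B_ne: "block_of Q i \<noteq> {}"
        using i R block_of(1)[OF Q] ne by (auto simp: subset_iff) metis
      have "block_of Q i' = block_of Q i \<longleftrightarrow> i' = i" if "i' \<in> R" for i'
        using inj_on_block_of[OF Q] that i R by (auto dest: inj_onD)
      then have "P k t (insert_into x (block_of Q i) Q) \<longleftrightarrow>
          card Q = card I + k \<and> (\<forall>i'\<in>R. card (block_of Q i') + of_bool (i' = i) = card (A i') + t i')"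
        using R B_ne by (auto simp: P_def card[OF B] size[OF B] subset_iff)
      \<comment> \<open>The block has at least \<open>card (A i)\<close> elements before
        \<open>x\<close> joins, which excludes \<open>t i = 0\<close>.\<close>
      also have "\<dots> \<longleftrightarrow> t i \<noteq> 0 \<and> P k (t(i := t i - 1)) Q"
        using card_block_of_ge[OF Z(1) Q iI] i by (fastforce simp: P_def)
      finally have P: "P k t (insert_into x (block_of Q i) Q) \<longleftrightarrow> t i \<noteq> 0 \<and> P k (t(i := t i - 1)) Q" .
      have "real (card (block_of Q i)) = real (card (A i) + t i) - 1"
        if "t i \<noteq> 0" "P k (t(i := t i - 1)) Q"
        using that i by (auto simp: P_def)
      then show ?thesis
        using B_ne by (auto simp: \<phi>_def P weight[OF B])
    qed
    have sub: "block_of Q ` R \<subseteq> Q"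
      using block_of(1)[OF Q] R by auto
    have "(\<Sum>B\<in>insert {} Q. \<phi> k t (insert_into x B Q)) =
        \<phi> k t (insert_into x {} Q) + (\<Sum>B\<in>Q. \<phi> k t (insert_into x B Q))"
      using finQ ne by simp
    also have "(\<Sum>B\<in>Q. \<phi> k t (insert_into x B Q)) =
        (\<Sum>B\<in>block_of Q ` R. \<phi> k t (insert_into x B Q))
        + (\<Sum>B\<in>Q - block_of Q ` R. \<phi> k t (insert_into x B Q))"
      using sum.subset_diff[OF sub finQ] by (simp add: add.commute)
    also have "(\<Sum>B\<in>block_of Q ` R. \<phi> k t (insert_into x B Q)) =
        (\<Sum>i\<in>R. \<phi> k t (insert_into x (block_of Q i) Q))"
      using sum.reindex[OF inj_on_subset[OF inj_on_block_of[OF Q] R]] by simp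
    also have "\<dots> = (\<Sum>i\<in>R. if t i = 0 then 0
         else (real (card (A i) + t i) - 1 - \<alpha>) * \<phi> k (t(i := t i - 1)) Q)"
      using old by (rule sum.cong[OF refl])
    also have "(\<Sum>B\<in>Q - block_of Q ` R. \<phi> k t (insert_into x B Q)) =
        \<phi> k t Q * (\<Sum>B\<in>Q - block_of Q ` R. real (card B) - \<alpha>)"
      unfolding sum_distrib_left using other by (rule sum.cong[OF refl])
    also have "\<dots> = (real (card Y + card Z) - (\<Sum>i\<in>R. real (card (A i) + t i))
        - (real (card I + k) - real (card R)) * \<alpha>) * \<phi> k t Q"
    \<comment> \<open>The coefficient needs the prescribed counts, which hold under
      \<open>P k t Q\<close>; otherwise \<open>\<phi> k t Q\<close> is zero.\<close>
    proof (cases "P k t Q")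
      case True
      then show ?thesis
        unfolding sum_other_blocks[OF Z Q R] by (simp add: P_def)
    qed (simp add: \<phi>_def)
    finally show ?thesis
      unfolding new by simp
  qed
  have "extension_weight \<alpha> R (insert x Z) t k =
      (\<Sum>(Q, B)\<in>(SIGMA Q:extensions Z. insert {} Q). \<phi> k t (insert_into x B Q))"
    unfolding ew
    by (subst sum.reindex_bij_betw[OF bij_betw_insert_into_extensions[OF x], symmetric])
      (simp add: case_prod_beta)
  also have "\<dots> = (\<Sum>Q\<in>extensions Z. \<Sum>B\<in>insert {} Q. \<phi> k t (insert_into x B Q))"
    using finite_extensions[OF Z(1)] finite_extension[OF Z(1)] by (subst sum.Sigma) auto
  also have "\<dots> = (\<Sum>Q\<in>extensions Z. (if k = 0 then 0 else \<phi> (k - 1) t Q))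
    + (\<Sum>i\<in>R. if t i = 0 then 0
         else (real (card (A i) + t i) - 1 - \<alpha>) * (\<Sum>Q\<in>extensions Z. \<phi> k (t(i := t i - 1)) Q))
    + (real (card Y + card Z) - (\<Sum>i\<in>R. real (card (A i) + t i)) - (real (card I + k) - real (card R)) * \<alpha>)
      * (\<Sum>Q\<in>extensions Z. \<phi> k t Q)"
  proof -
    have "(\<Sum>Q\<in>extensions Z. \<Sum>i\<in>R. if t i = 0 then 0
         else (real (card (A i) + t i) - 1 - \<alpha>) * \<phi> k (t(i := t i - 1)) Q) =
      (\<Sum>i\<in>R. if t i = 0 then 0
         else (real (card (A i) + t i) - 1 - \<alpha>) * (\<Sum>Q\<in>extensions Z. \<phi> k (t(i := t i - 1)) Q))"
      by (subst sum.swap) (auto simp: sum_distrib_left intro!: sum.cong)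
    then show ?thesis
      by (simp only: step sum.distrib sum_distrib_left cong: sum.cong)
  qed
  finally show ?thesis
    unfolding ew by (cases k) simp_all
qed

text \<open>Induction on \<open>Z\<close>, both sides obeying the same recursion. The number
  \<open>\<rho> R\<close> is the sum of \<open>card (A i) - \<alpha>\<close> over the indices
  outside \<open>R\<close>. The conditional keeps truncated subtraction from giving a value when the
  gains exceed \<open>card Z\<close>.\<close>

lemma extension_weight_closed_form:
  fixes \<alpha> :: real
  defines "\<rho> R \<equiv> real (card Y) - (\<Sum>i\<in>R. real (card (A i))) - (real (card I) - real (card R)) * \<alpha>"
  assumes "finite Z" "Y \<inter> Z = {}" and R: "R \<subseteq> I"
  shows "extension_weight \<alpha> R Z t k = block_weight \<alpha> (A ` I) * fact (card Z)
      * (\<Prod>i\<in>R. pochhammer (real (card (A i)) - \<alpha>) (t i) / fact (t i))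
      * (if sum t R \<le> card Z then nc_stirling_fps \<alpha> (\<rho> R) k $ (card Z - sum t R) else 0)"
  using assms(2,3)
proof (induction Z arbitrary: t k rule: finite_induct)
  case empty
  have "block_of (A ` I) i = A i" if "i \<in> I" for i
    using that by (intro block_of_eqI[of _ "{}"]) (auto simp: extensions_empty)
  then have "extension_weight \<alpha> R {} t k = of_bool (k = 0 \<and> (\<forall>i\<in>R. t i = 0)) * block_weight \<alpha> (A ` I)"
    using R card_image[OF inj_A] by (auto simp: extension_weight_def extensions_empty subset_iff)
  moreover have "sum t R = 0 \<longleftrightarrow> (\<forall>i\<in>R. t i = 0)"
    using finite_subset[OF R finite_I] by simp
  ultimately show ?case
    by (auto simp: nc_stirling_fps_nth_0)
next
  case (insert x Z)
  have finR: "finite R"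
    using R finite_I by (rule finite_subset)
  have x: "x \<notin> Y \<union> Z" and disj: "Y \<inter> Z = {}"
    using insert by auto
  define m where "m = card Z"
  define W where "W = block_weight \<alpha> (A ` I)"
  define D where "D t = (\<Prod>i\<in>R. pochhammer (real (card (A i)) - \<alpha>) (t i) / fact (t i))" for t :: "'i \<Rightarrow> nat"
  define u where "u m \<sigma> k = (if \<sigma> \<le> m then nc_stirling_fps \<alpha> (\<rho> R) k $ (m - \<sigma>) else 0)" for m \<sigma> k :: nat
  define \<sigma> where "\<sigma> = sum t R"
  have IH: "extension_weight \<alpha> R Z t k = W * fact m * D t * u m (sum t R) k" for t k
    using insert.IH[OF disj] by (simp add: W_def m_def D_def u_def)
  \<comment> \<open>The factor completes the Pochhammer symbol to length \<open>t i\<close>, and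
    passing to the factorial of \<open>t i\<close> leaves the multiplier \<open>t i\<close>; these
    multipliers then add up to \<open>\<sigma>\<close>.\<close>
  have lower: "(real (card (A i) + t i) - 1 - \<alpha>) * extension_weight \<alpha> R Z (t(i := t i - 1)) k
      = W * fact m * D t * real (t i) * u m (\<sigma> - 1) k" if i: "i \<in> R" and "t i \<noteq> 0" for i
  proof -
    obtain s where s: "t i = Suc s"
      using \<open>t i \<noteq> 0\<close> not0_implies_Suc by blast
    have sum: "sum (t(i := t i - 1)) R = \<sigma> - 1"
      using sum.remove[OF finR i, of t] sum.remove[OF finR i, of "t(i := t i - 1)"] s
      by (simp add: \<sigma>_def)
    have D: "D t = pochhammer (real (card (A i)) - \<alpha>) (Suc s) / fact (Suc s)
        * (\<Prod>i\<in>R - {i}. pochhammer (real (card (A i)) - \<alpha>) (t i) / fact (t i))"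
      by (simp only: D_def prod.remove[OF finR i] s)
    have D': "D (t(i := t i - 1)) = pochhammer (real (card (A i)) - \<alpha>) s / fact s
        * (\<Prod>i\<in>R - {i}. pochhammer (real (card (A i)) - \<alpha>) (t i) / fact (t i))"
      unfolding D_def prod.remove[OF finR i] using s by (simp cong: prod.cong_simp)
    have step: "pochhammer (real (card (A i)) - \<alpha>) (Suc s) / fact (Suc s) * real (Suc s)
        = (real (card (A i) + t i) - 1 - \<alpha>) * (pochhammer (real (card (A i)) - \<alpha>) s / fact s)"
      using s by (simp add: pochhammer_Suc divide_simps)
    have "(real (card (A i) + t i) - 1 - \<alpha>) * D (t(i := t i - 1)) = D t * real (t i)"
      unfolding D D' mult.assoc[symmetric] step[symmetric] unfolding s by (simp only: mult_ac)
    then show ?thesis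
      unfolding IH sum by (simp only: mult.assoc mult.commute mult.left_commute)
  qed
  have "(\<Sum>i\<in>R. if t i = 0 then 0
         else (real (card (A i) + t i) - 1 - \<alpha>) * extension_weight \<alpha> R Z (t(i := t i - 1)) k)
      = (\<Sum>i\<in>R. W * fact m * D t * real (t i) * u m (\<sigma> - 1) k)"
    using lower by (intro sum.cong) auto
  also have "\<dots> = W * fact m * D t * (real \<sigma> * u m (\<sigma> - 1) k)"
    by (simp add: \<sigma>_def sum_distrib_left sum_distrib_right mult_ac)
  \<comment> \<open>For positive \<open>\<sigma>\<close> both coefficients have index
    \<open>m + 1 - \<sigma>\<close>; for \<open>\<sigma> = 0\<close> the factor is zero.\<close>
  also have "real \<sigma> * u m (\<sigma> - 1) k = real \<sigma> * u (m + 1) \<sigma> k"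
    by (cases \<sigma>) (auto simp: u_def)
  finally have old: "(\<Sum>i\<in>R. if t i = 0 then 0
         else (real (card (A i) + t i) - 1 - \<alpha>) * extension_weight \<alpha> R Z (t(i := t i - 1)) k)
      = W * fact m * D t * (real \<sigma> * u (m + 1) \<sigma> k)" .
  have coeff: "real (card Y + card Z) - (\<Sum>i\<in>R. real (card (A i) + t i))
      - (real (card I + k) - real (card R)) * \<alpha> = real m - real \<sigma> + \<rho> R - real k * \<alpha>"
    by (simp add: \<rho>_def \<sigma>_def m_def sum.distrib algebra_simps)
  \<comment> \<open>For \<open>\<sigma> = m + 1\<close> the factor on the left vanishes; for larger
    \<open>\<sigma>\<close> every \<open>u\<close> does.\<close>
  have rec: "(real (m + 1) - real \<sigma>) * u (m + 1) \<sigma> k =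
      (if k = 0 then 0 else u m \<sigma> (k - 1)) + (real m - real \<sigma> + \<rho> R - real k * \<alpha>) * u m \<sigma> k"
  proof (cases "\<sigma> \<le> m")
    case True
    then show ?thesis
      using nc_stirling_fps_rec[of "m - \<sigma>" \<alpha> "\<rho> R" k]
      by (simp add: u_def of_nat_diff Suc_diff_le add_diff_eq)
  qed (auto simp: u_def)
  have "extension_weight \<alpha> R (insert x Z) t k =
      W * fact m * D t * ((if k = 0 then 0 else u m \<sigma> (k - 1)) + real \<sigma> * u (m + 1) \<sigma> k
        + (real m - real \<sigma> + \<rho> R - real k * \<alpha>) * u m \<sigma> k)"
    unfolding extension_weight_insert[OF insert.hyps(1) disj x R] old coeff
    unfolding IH \<sigma>_def[symmetric]
    by (simp add: algebra_simps)
  \<comment> \<open>The prescribed blocks supply the missing \<open>\<sigma>\<close>, giving the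
    factor \<open>m + 1\<close> that raises the factorial.\<close>
  also have "\<dots> = W * fact m * D t * (real (m + 1) * u (m + 1) \<sigma> k)"
  proof -
    have "(if k = 0 then 0 else u m \<sigma> (k - 1)) + real \<sigma> * u (m + 1) \<sigma> k
        + (real m - real \<sigma> + \<rho> R - real k * \<alpha>) * u m \<sigma> k = real (m + 1) * u (m + 1) \<sigma> k"
      using rec unfolding left_diff_distrib[of "real (m + 1)" "real \<sigma>"] by linarith
    then show ?thesis
      by (rule arg_cong)
  qed
  also have "\<dots> = W * fact (m + 1) * D t * u (m + 1) \<sigma> k"
    by (simp add: algebra_simps)
  finally show ?case
    using insert.hyps by (simp add: W_def D_def u_def m_def \<sigma>_def)
qed

end

section \<open>Application to the Gibbs partition\<close>

lemma restrict_partition_restrict_partition: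
  "n \<le> m \<Longrightarrow> restrict_partition n (restrict_partition m P) = restrict_partition n P"
proof -
  assume "n \<le> m"
  then have "{1..n} \<inter> ({1..m} \<inter> C) = {1..n} \<inter> C" for C
    by auto
  moreover have "(\<inter>) {1..n} ` ((\<inter>) {1..m} ` P - {{}}) - {{}} = (\<inter>) {1..n} ` (\<inter>) {1..m} ` P - {{}}"
    by blast
  ultimately show ?thesis
    by (simp only: restrict_partition_def image_image)
qed

theorem proposition9:
  fixes \<alpha> :: real and V :: "nat \<Rightarrow> nat \<Rightarrow> real"
    and M :: "'a measure" and \<pi> :: "'a \<Rightarrow> nat set set"
    and n m j r :: nat
    and A :: "nat \<Rightarrow> nat set" and ns ms :: "nat \<Rightarrow> nat"
  assumes "gibbs_partition \<alpha> V M \<pi>"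
    and "1 \<le> n" and "1 \<le> m"
    and "partition_on {1..n} (A ` {1..j})" and "inj_on A {1..j}"
    and "\<And>i. i \<in> {1..j} \<Longrightarrow> ns i = card (A i)"
    and "V n j > 0"
    and "1 \<le> r" and "r \<le> j"
    and "(\<Sum>i=1..r. ms i) \<le> m"
  shows "\<P>(\<omega> in M. (\<forall>i\<in>{1..r}. old_block_gain n m (\<pi> \<omega>) (A i) = ms i)
             \<bar> restrict_partition n (\<pi> \<omega>) = A ` {1..j})
    = fact m * (\<Prod>i=1..r. pochhammer (real (ns i) - \<alpha>) (ms i))
        / ((\<Prod>i=1..r. fact (ms i)) * fact (m - (\<Sum>i=1..r. ms i)))
      * (\<Sum>k=0..m - (\<Sum>i=1..r. ms i).
           V (n + m) (j + k) / V n j *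
           nc_gen_stirling \<alpha> (- (real n - (real j - real r) * \<alpha> - (\<Sum>i=1..r. real (ns i))))
             (m - (\<Sum>i=1..r. ms i)) k)"
proof -
  interpret gibbs_partition \<alpha> V M \<pi> by fact
  interpret indexed_partition A "{1..j}" "{1..n}"
    using assms by unfold_locales auto
  define Z where "Z = {n + 1..n + m}"
  define R where "R = {1..r}"
  define \<sigma> where "\<sigma> = (\<Sum>i=1..r. ms i)"
  define \<rho> where "\<rho> = real n - (real j - real r) * \<alpha> - (\<Sum>i=1..r. real (ns i))"
  define W where "W = block_weight \<alpha> (A ` {1..j})"
  define D where "D = (\<Prod>i=1..r. pochhammer (real (ns i) - \<alpha>) (ms i) / fact (ms i))"
  define S where "S = {Q \<in> extensions Z. \<forall>i\<in>R. card (block_of Q i) = card (A i) + ms i}"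
  have Z: "finite Z" "{1..n} \<inter> Z = {}" "{1..n} \<union> Z = {1..n + m}" "card Z = m"
    by (auto simp: Z_def)
  have R: "R \<subseteq> {1..j}"
    using assms by (auto simp: R_def)
  have finS: "finite S"
    using finite_extensions[OF Z(1)] by (simp add: S_def)
  have part: "partition_on {1..n + m} Q" if "Q \<in> S" for Q
    using that extensionsD(1)[of Q Z] unfolding S_def Z(3) by blast
  have ns: "ns i = card (A i)" if "i \<in> R" for i
    using that R assms by blast

  \<comment> \<open>Both conditions depend only on the restriction to \<open>{1..n + m}\<close>, so
    the event is a finite disjoint union of events with known probability.\<close>
  have event: "{\<omega> \<in> space M. (\<forall>i\<in>{1..r}. old_block_gain n m (\<pi> \<omega>) (A i) = ms i)
        \<and> restrict_partition n (\<pi> \<omega>) = A ` {1..j}} =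
      (\<Union>Q\<in>S. {\<omega> \<in> space M. restrict_partition (n + m) (\<pi> \<omega>) = Q})"
  proof -
    have "(\<forall>i\<in>{1..r}. old_block_gain n m (\<pi> \<omega>) (A i) = ms i) \<and> restrict_partition n (\<pi> \<omega>) = A ` {1..j}
        \<longleftrightarrow> restrict_partition (n + m) (\<pi> \<omega>) \<in> S" if \<omega>: "\<omega> \<in> space M" for \<omega>
    proof -
      define Q where "Q = restrict_partition (n + m) (\<pi> \<omega>)"
      have "partition_on {1..n + m} Q"
        unfolding Q_def by (rule partition_on_restrict_partition[OF partition_on_\<pi>[OF \<omega>]])
      moreover have "restrict_partition n (\<pi> \<omega>) = (\<inter>) {1..n} ` Q - {{}}"
        using restrict_partition_restrict_partition[of n "n + m" "\<pi> \<omega>"]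
        by (simp add: Q_def restrict_partition_def[of n])
      ultimately have ext: "restrict_partition n (\<pi> \<omega>) = A ` {1..j} \<longleftrightarrow> Q \<in> extensions Z"
        unfolding extensions_def Z(3) by simp
      have "old_block_gain n m (\<pi> \<omega>) (A i) = ms i \<longleftrightarrow> card (block_of Q i) = card (A i) + ms i"
        if Q: "Q \<in> extensions Z" and i: "i \<in> R" for i
      proof -
        have B: "block_of Q i \<in> Q" "{1..n} \<inter> block_of Q i = A i"
          using block_of[OF Q, of i] i R by blast+
        have "block_of Q i \<subseteq> {1..n} \<union> Z"
          using B(1) partition_onD1[OF extensionsD(1)[OF Q]] by blast
        \<comment> \<open>The gain is the part of the old block in \<open>Z\<close>, so prescribing
          gains amounts to prescribing sizes.\<close>
        then have "block_of Q i = A i \<union> (block_of Q i \<inter> Z)" "A i \<inter> (block_of Q i \<inter> Z) = {}"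
          using B(2) Z(2) by auto
        moreover have "finite (A i)" "finite (block_of Q i \<inter> Z)"
          using finite_subset[of "A i" "{1..n}"] B(2) Z(1) by blast+
        ultimately have "card (block_of Q i) = card (A i) + card (block_of Q i \<inter> Z)"
          by (metis card_Un_disjoint)
        then show ?thesis
          by (simp add: old_block_gain_def old_block_def block_of_def Q_def Z_def)
      qed
      then show ?thesis
        unfolding ext unfolding S_def R_def Q_def by blast
    qed
    then show ?thesis
      by blast
  qed

  have prob_Q: "\<P>(\<omega> in M. restrict_partition (n + m) (\<pi> \<omega>) = Q) = V (n + m) (card Q) * block_weight \<alpha> Q"
    if "Q \<in> S" for Q
    using prob_restrict[OF _ part[OF that]] assms(2) by (simp add: block_weight_def)
  have "\<P>(\<omega> in M. (\<forall>i\<in>{1..r}. old_block_gain n m (\<pi> \<omega>) (A i) = ms i)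
        \<and> restrict_partition n (\<pi> \<omega>) = A ` {1..j}) =
      (\<Sum>Q\<in>S. \<P>(\<omega> in M. restrict_partition (n + m) (\<pi> \<omega>) = Q))"
    unfolding event using finS restrict_event[OF part]
    by (intro finite_measure_finite_Union) (auto simp: disjoint_family_on_def)
  also have "\<dots> = (\<Sum>Q\<in>S. V (n + m) (card Q) * block_weight \<alpha> Q)"
    using prob_Q by (rule sum.cong[OF refl])
  \<comment> \<open>Sorting by the number of new blocks lets \<open>V\<close> leave the inner sum.
    The bound \<open>n + m\<close> is crude but covers every \<open>card Q - j\<close>.\<close>
  also have "\<dots> = (\<Sum>Q\<in>S. \<Sum>k=0..n + m. of_bool (card Q = j + k) * (V (n + m) (j + k) * block_weight \<alpha> Q))"
  proof (rule sum.cong[OF refl])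
    fix Q assume Q: "Q \<in> S"
    have "j \<le> card Q"
      using card_extension_ge[OF Z(1), of Q] Q by (simp add: S_def)
    moreover have "card Q \<le> n + m"
      using card_partition_le[OF _ part[OF Q]] by simp
    ultimately have "card Q - j \<in> {0..n + m}" "\<And>k. card Q = j + k \<longleftrightarrow> k = card Q - j" "j + (card Q - j) = card Q"
      by auto
    then show "V (n + m) (card Q) * block_weight \<alpha> Q =
        (\<Sum>k=0..n + m. of_bool (card Q = j + k) * (V (n + m) (j + k) * block_weight \<alpha> Q))"
      by (simp add: of_bool_def if_distrib[of "\<lambda>c. c * _"] cong: if_cong del: atLeastAtMost_iff)
  qed
  also have "\<dots> = (\<Sum>k=0..n + m. V (n + m) (j + k) *
      (\<Sum>Q\<in>S. of_bool (card Q = j + k) * block_weight \<alpha> Q))"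
    by (subst sum.swap) (simp add: sum_distrib_left mult_ac)
  also have "\<dots> = (\<Sum>k=0..n + m. V (n + m) (j + k) * extension_weight \<alpha> R Z ms k)"
  proof -
    have "(\<Sum>Q\<in>S. of_bool (card Q = j + k) * block_weight \<alpha> Q) = extension_weight \<alpha> R Z ms k" for k
      unfolding extension_weight_def using finite_extensions[OF Z(1)]
      by (intro sum.mono_neutral_cong_left) (auto simp: S_def)
    then show ?thesis
      by simp
  qed
  also have "\<dots> = (\<Sum>k=0..n + m. V (n + m) (j + k) *
      (W * fact m * D * (nc_gen_stirling \<alpha> (- \<rho>) (m - \<sigma>) k / fact (m - \<sigma>))))"
  proof -
    have \<rho>_eq: "\<rho> = real (card {1..n}) - (\<Sum>i\<in>R. real (card (A i))) - (real (card {1..j}) - real (card R)) * \<alpha>"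
      using ns by (simp add: \<rho>_def R_def)
    have D_eq: "D = (\<Prod>i\<in>R. pochhammer (real (card (A i)) - \<alpha>) (ms i) / fact (ms i))"
      using ns by (simp add: D_def R_def)
    have "extension_weight \<alpha> R Z ms k =
        W * fact m * D * (nc_gen_stirling \<alpha> (- \<rho>) (m - \<sigma>) k / fact (m - \<sigma>))" for k
      using extension_weight_closed_form[OF Z(1,2) R, of \<alpha> ms k, folded \<rho>_eq D_eq W_def] assms(10)
      by (simp add: nc_gen_stirling_eq_fps_nth \<sigma>_def Z(4) R_def)
    then show ?thesis
      by simp
  qed
  \<comment> \<open>For \<open>k > m - \<sigma>\<close> the sum defining
    \<open>nc_gen_stirling\<close> is empty.\<close>
  also have "\<dots> = (\<Sum>k=0..m - \<sigma>. V (n + m) (j + k) *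
      (W * fact m * D * (nc_gen_stirling \<alpha> (- \<rho>) (m - \<sigma>) k / fact (m - \<sigma>))))"
    by (intro sum.mono_neutral_right) (auto simp: nc_gen_stirling_def)
  finally have joint: "\<P>(\<omega> in M. (\<forall>i\<in>{1..r}. old_block_gain n m (\<pi> \<omega>) (A i) = ms i)
        \<and> restrict_partition n (\<pi> \<omega>) = A ` {1..j}) = \<dots>" .

  have condition: "\<P>(\<omega> in M. restrict_partition n (\<pi> \<omega>) = A ` {1..j}) = V n j * W"
    using prob_restrict[OF assms(2,4)] card_image[OF assms(5)] by (simp add: W_def block_weight_def)
  \<comment> \<open>The weight \<open>W\<close> of the given blocks is common to the joint
    probability and that of the condition, and cancels in the quotient.\<close>
  have "W > 0"
    unfolding W_def block_weight_def using \<alpha>_less_1 by (intro prod_pos ballI pochhammer_pos) simp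
  then show ?thesis
    unfolding cond_prob_def joint condition \<sigma>_def[symmetric] \<rho>_def[symmetric] sum_distrib_left
    unfolding sum_divide_distrib
    using assms(7) by (intro sum.cong refl) (simp add: D_def prod_dividef field_simps)
qed

end
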